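(* Let $R$ be a Noetherian ring, let $\mathcal{I}=\{I_m\}_{m\in\mathbb{N}}$ be a filtration in $R$ and let $\alpha\in\mathbb{R}_{>0}$. Then $\overline{\nu}_{\mathcal{I}}=\alpha\,\overline{\nu}_{\mathcal{I}^{(\alpha)}}$, where $\mathcal{I}^{(\alpha)}=\{I_{\lceil\alpha m\rceil}\}_{m\in\mathbb{N}}$.
   Context: Rings are commutative with identity, and $\mathbb{N}$ denotes the nonnegative integers. A filtration of a ring $R$ is a family $\mathcal{I} = \{I_m\}_{m\in\mathbb{N}}$ of ideals of $R$ with $I_0 = R$, $I_n \supseteq I_{n+1}$ and $I_n I_m \subseteq I_{n+m}$ for all $m,n \in \mathbb{N}$. The order of $\mathcal{I}$ is $\nu_{\mathcal{I}}(f) = \sup\{m \mid f \in I_m\} \in \mathbb{N}\cup\{\infty\}$ for $f \in R$. The asymptotic Samuel function of $\mathcal{I}$ is $\overline{\nu}_{\mathcal{I}} : R \to \mathbb{R}_{\ge 0}\cup\{\infty\}$, $\overline{\nu}_{\mathcal{I}}(x) = \lim_{n\to\infty} \nu_{\mathcal{I}}(x^n)/n$ (this limit always exists in $\mathbb{R}_{\ge 0}\cup\{\infty\}$); $\alpha\cdot\infty=\infty$ for $\alpha\in\mathbb{R}_{>0}$. The family $\mathcal{I}^{(\alpha)}$ is again a filtration of $R$. *)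

theory Defs
  imports
    "HOL-Algebra.Ideal_Product"
    "HOL-Algebra.Ring_Divisibility"
    "HOL-Library.Extended_Nonnegative_Real"
begin

locale filtration = cring R for R (structure) +
  fixes I :: "nat \<Rightarrow> 'a set"
  assumes filtration_ideal: "ideal (I m) R"
    and filtration_zero: "I 0 = carrier R"
    and filtration_Suc_subset: "I (Suc n) \<subseteq> I n"
    and filtration_mult: "ideal_prod R (I n) (I m) \<subseteq> I (n + m)"

definition filtration_order :: "(nat \<Rightarrow> 'a set) \<Rightarrow> 'a \<Rightarrow> enat" where
  "filtration_order I f = (SUP m \<in> {m. f \<in> I m}. enat m)"

text \<open>
  For a filtration, \<open>n \<mapsto> filtration_order I (x\<^sup>n)\<close> is superadditive, so the limit exists in
  \<open>[0, \<infinity>]\<close>. The term at \<open>n = 0\<close> is a division by zero and does not affect the limit.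
\<close>

definition asymptotic_samuel ::
    "('a, 'b) ring_scheme \<Rightarrow> (nat \<Rightarrow> 'a set) \<Rightarrow> 'a \<Rightarrow> ennreal" where
  "asymptotic_samuel R I x =
     lim (\<lambda>n. ennreal_of_enat (filtration_order I (x [^]\<^bsub>R\<^esub> n)) / of_nat n)"

text \<open>Used only for \<open>\<alpha> > 0\<close>, where the ceiling is nonnegative and \<open>nat\<close> loses nothing.\<close>

definition scaled_filtration :: "real \<Rightarrow> (nat \<Rightarrow> 'a set) \<Rightarrow> nat \<Rightarrow> 'a set" where
  "scaled_filtration \<alpha> I m = I (nat \<lceil>\<alpha> * real m\<rceil>)"

lemma (in filtration) filtration_antimono:
  assumes "m \<le> n"
  shows "I n \<subseteq> I m"
  using lift_Suc_antimono_le[of I, OF filtration_Suc_subset assms] .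

lemma (in filtration) filtration_scaled:
  assumes "\<alpha> > 0"
  shows "filtration R (scaled_filtration \<alpha> I)"
proof (intro filtration.intro is_cring filtration_axioms.intro)
  fix m n
  show "ideal (scaled_filtration \<alpha> I m) R"
    by (simp add: scaled_filtration_def filtration_ideal)
  show "scaled_filtration \<alpha> I 0 = carrier R"
    by (simp add: scaled_filtration_def filtration_zero)
  have "\<alpha> * real n \<le> \<alpha> * real (Suc n)"
    using assms by simp
  then show "scaled_filtration \<alpha> I (Suc n) \<subseteq> scaled_filtration \<alpha> I n"
    unfolding scaled_filtration_def by (intro filtration_antimono nat_mono ceiling_mono)
  have "nat \<lceil>\<alpha> * real (n + m)\<rceil> \<le> nat (\<lceil>\<alpha> * real n\<rceil> + \<lceil>\<alpha> * real m\<rceil>)"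
    by (intro nat_mono) (simp add: distrib_left ceiling_add_le)
  also have "\<dots> = nat \<lceil>\<alpha> * real n\<rceil> + nat \<lceil>\<alpha> * real m\<rceil>"
    using assms by (simp add: nat_add_distrib less_le_trans[of "-1" 0])
  finally show "ideal_prod R (scaled_filtration \<alpha> I n) (scaled_filtration \<alpha> I m)
      \<subseteq> scaled_filtration \<alpha> I (n + m)"
    unfolding scaled_filtration_def using filtration_mult filtration_antimono by blast
qed

end

theory Submission
  imports Defs
begin

text \<open>
  Since \<open>f \<in> I \<lceil>\<alpha> m\<rceil>\<close> means \<open>\<alpha> m \<le> \<nu>(f)\<close>, the order of \<open>f\<close> in the scaled filtration is
  \<open>\<lfloor>\<nu>(f) / \<alpha>\<rfloor>\<close>, so \<open>\<alpha>\<close> times it differs from \<open>\<nu>(f)\<close> by at most \<open>\<alpha>\<close>. This bounded error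
  disappears after dividing by \<open>n\<close>. That the limits exist at all is Fekete's lemma for the
  superadditive sequence \<open>n \<mapsto> \<nu>(x\<^sup>n)\<close>.
\<close>

lemma superadditive_mult_le:
  fixes a :: "nat \<Rightarrow> ennreal"
  assumes super: "\<And>m n. a m + a n \<le> a (m + n)"
  shows "of_nat q * a k \<le> a (q * k)"
proof (induction q)
  case (Suc q)
  have "of_nat (Suc q) * a k = a k + of_nat q * a k"
    by (simp add: algebra_simps)
  also have "\<dots> \<le> a k + a (q * k)"
    using Suc by (intro add_left_mono)
  also have "\<dots> \<le> a (Suc q * k)"
    using super[of k "q * k"] by simp
  finally show ?case .
qed simp

text \<open>Division with remainder gives n = q * k + r with r < k, so \<open>a n\<close> is at
  least \<open>q * a k\<close>, and n \<le> q * k + k turns the ratio q / n into at least (1 - k /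
  n) / k. For fixed k the correction factor tends to 1.\<close>

lemma superadditive_div_lower_bound:
  fixes a :: "nat \<Rightarrow> ennreal"
  assumes super: "\<And>m n. a m + a n \<le> a (m + n)"
    and "k > 0" "n > 0"
  shows "a k / of_nat k * ennreal (1 - real k / real n) \<le> a n / of_nat n"
proof -
  define q where "q = n div k"
  have "real n \<le> real q * real k + real k"
  proof -
    have "n = q * k + n mod k" by (simp add: q_def)
    moreover have "n mod k \<le> k" using assms(2) by (simp add: less_imp_le)
    ultimately have "n \<le> q * k + k" by linarith
    then show ?thesis by (metis of_nat_add of_nat_le_iff of_nat_mult)
  qed
  then have "(real n - real k) / real n \<le> real q * real k / real n"
    by (intro divide_right_mono) simp_all
  then have "1 - real k / real n \<le> real q / real n * real k"
    using assms(3) by (simp add: diff_divide_distrib)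
  then have le: "(1 - real k / real n) / real k \<le> real q / real n"
    using assms(2) by (subst pos_divide_le_eq) simp_all
  have "a k / of_nat k * ennreal (1 - real k / real n)
      = a k * (ennreal (1 - real k / real n) / of_nat k)"
    by (simp only: divide_ennreal_def mult_ac)
  also have "\<dots> \<le> a k * (of_nat q / of_nat n)"
  proof (intro mult_left_mono)
    have "ennreal (1 - real k / real n) / of_nat k = ennreal ((1 - real k / real n) / real k)"
    proof (cases "k \<le> n")
      case True
      then show ?thesis
        using assms(2) by (simp add: divide_ennreal ennreal_of_nat_eq_real_of_nat)
    next
      \<comment> \<open>For n < k the factor is negative, and \<open>ennreal\<close> truncates both
        sides to 0.\<close>
      case False
      then have "1 - real k / real n \<le> 0"
        using assms(3) by simp
      then show ?thesis
        using assms(2) by (simp add: ennreal_neg divide_nonpos_pos)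
    qed
    also have "\<dots> \<le> ennreal (real q / real n)"
      using le by (rule ennreal_leI)
    also have "\<dots> = of_nat q / of_nat n"
      using assms(3) by (simp add: divide_ennreal ennreal_of_nat_eq_real_of_nat)
    finally show "ennreal (1 - real k / real n) / of_nat k \<le> of_nat q / of_nat n" .
  qed simp
  also have "\<dots> = of_nat q * a k / of_nat n"
    by (simp only: divide_ennreal_def mult_ac)
  also have "\<dots> \<le> a (q * k) / of_nat n"
    by (intro divide_right_mono_ennreal superadditive_mult_le super)
  also have "\<dots> \<le> a n / of_nat n"
  proof (intro divide_right_mono_ennreal)
    have "a (q * k) \<le> a (q * k) + a (n mod k)" by simp
    also have "\<dots> \<le> a n" using super[of "q * k" "n mod k"] by (simp add: q_def)
    finally show "a (q * k) \<le> a n" .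
  qed
  finally show ?thesis .
qed

text \<open>The supremum bounds every term with n > 0. Conversely, one index k whose quotient
  exceeds c forces all large n above c, by the preceding bound.\<close>

lemma fekete_superadditive_ennreal:
  fixes a :: "nat \<Rightarrow> ennreal"
  assumes super: "\<And>m n. a m + a n \<le> a (m + n)"
  shows "(\<lambda>n. a n / of_nat n) \<longlonglongrightarrow> (SUP n\<in>{0<..}. a n / of_nat n)"
proof (rule order_tendstoI)
  fix c assume "c < (SUP n\<in>{0<..}. a n / of_nat n)"
  then obtain k where k: "k > 0" "c < a k / of_nat k"
    by (auto simp: less_SUP_iff)
  \<comment> \<open>The quotient at k may be infinite. An intermediate d is finite, as
    \<open>ennreal_tendsto_cmult\<close> requires, and c < d leaves room for the factor that tends
    to 1.\<close>
  then obtain d where d: "c < d" "d < a k / of_nat k"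
    using dense by blast
  have "(\<lambda>n. 1 - real k / real n) \<longlonglongrightarrow> 1 - 0"
    by (intro tendsto_intros lim_const_over_n)
  then have "(\<lambda>n. ennreal (1 - real k / real n)) \<longlonglongrightarrow> 1"
    using tendsto_ennrealI by fastforce
  then have "(\<lambda>n. d * ennreal (1 - real k / real n)) \<longlonglongrightarrow> d * 1"
    using d(2) by (intro ennreal_tendsto_cmult) (auto intro: less_le_trans)
  then have "\<forall>\<^sub>F n in sequentially. c < d * ennreal (1 - real k / real n)"
    using d(1) by (auto dest: order_tendstoD)
  then show "\<forall>\<^sub>F n in sequentially. c < a n / of_nat n"
    using eventually_gt_at_top[of 0]
  proof eventually_elim
    case (elim n)
    have "d * ennreal (1 - real k / real n) \<le> a k / of_nat k * ennreal (1 - real k / real n)"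
      using d(2) by (intro mult_right_mono) auto
    also have "\<dots> \<le> a n / of_nat n"
      using super k(1) elim(2) by (rule superadditive_div_lower_bound)
    finally show ?case using elim(1) by simp
  qed
next
  fix c assume c: "(SUP n\<in>{0<..}. a n / of_nat n) < c"
  show "\<forall>\<^sub>F n in sequentially. a n / of_nat n < c"
    using eventually_gt_at_top[of 0]
  proof eventually_elim
    case (elim n)
    then show ?case using c by (meson SUP_upper greaterThan_iff le_less_trans)
  qed
qed

lemma ennreal_of_enat_add:
  "ennreal_of_enat (m + n) = ennreal_of_enat m + ennreal_of_enat n"
  by (cases m; cases n) auto

text \<open>Testing against finite lower bounds treats finite and infinite orders alike: if n < m,
  then n is some \<open>enat j\<close>, and \<open>Suc j\<close> separates the two.\<close>

lemma enat_leI: "(\<And>k. enat k \<le> m \<Longrightarrow> enat k \<le> n) \<Longrightarrow> m \<le> n"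
proof (rule ccontr)
  assume le: "\<And>k. enat k \<le> m \<Longrightarrow> enat k \<le> n" and "\<not> m \<le> n"
  then obtain j where "n = enat j" "enat (Suc j) \<le> m"
    by (cases n) (auto simp: not_le Suc_ile_eq)
  with le[of "Suc j"] show False by simp
qed

context filtration
begin

text \<open>The indices m with f in \<open>I m\<close> contain 0 and are downward closed, since the
  ideals decrease. Comparisons of orders thereby become membership statements.\<close>

lemma enat_le_filtration_order_iff:
  assumes "f \<in> carrier R"
  shows "enat m \<le> filtration_order I f \<longleftrightarrow> f \<in> I m"
proof
  assume "f \<in> I m"
  then show "enat m \<le> filtration_order I f"
    unfolding filtration_order_def by (intro SUP_upper) simp
next
  assume le: "enat m \<le> filtration_order I f"
  show "f \<in> I m"
  proof (cases m)
    case 0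
    then show ?thesis using assms filtration_zero by simp
  next
    case (Suc j)
    \<comment> \<open>Strictly below a supremum there is an actual index i > j, hence i \<ge>
      m.\<close>
    have "enat j < filtration_order I f"
      using le Suc by (metis Suc_ile_eq)
    then obtain i where "f \<in> I i" "j < i"
      unfolding filtration_order_def by (auto simp: less_SUP_iff)
    then show ?thesis
      using filtration_antimono[of m i] Suc by auto
  qed
qed

text \<open>Any finite k below the sum splits as i + j with f in \<open>I i\<close> and g in
  \<open>I j\<close>, so the product lies in \<open>I (i + j)\<close>. If the order of f reaches k,
  the split is k + 0; otherwise i is that finite order and g supplies the rest.\<close>

lemma filtration_order_mult:
  assumes f: "f \<in> carrier R" and g: "g \<in> carrier R"
  shows "filtration_order I f + filtration_order I g \<le> filtration_order I (f \<otimes> g)"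
proof (rule enat_leI)
  fix k assume k: "enat k \<le> filtration_order I f + filtration_order I g"
  obtain i j where ij: "k = i + j"
    "enat i \<le> filtration_order I f" "enat j \<le> filtration_order I g"
  proof (cases "enat k \<le> filtration_order I f")
    case True
    then show ?thesis using that[of k 0] by (simp add: zero_enat_def[symmetric])
  next
    case False
    then obtain i where i: "filtration_order I f = enat i" "i < k"
      by (cases "filtration_order I f") auto
    then show ?thesis using that[of i "k - i"] k
      by (cases "filtration_order I g") auto
  qed
  then have "f \<in> I i" "g \<in> I j"
    using enat_le_filtration_order_iff f g by auto
  then have "f \<otimes> g \<in> I (i + j)"
    using filtration_mult[of i j] by (blast intro: ideal_prod.prod)
  then show "enat k \<le> filtration_order I (f \<otimes> g)"
    using enat_le_filtration_order_iff f g ij(1) by auto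
qed

text \<open>This makes the \<open>lim\<close> in \<open>asymptotic_samuel\<close> a genuine
  limit.\<close>

lemma convergent_filtration_order_pow:
  assumes "x \<in> carrier R"
  shows "convergent (\<lambda>n. ennreal_of_enat (filtration_order I (x [^] n)) / of_nat n)"
proof -
  have "ennreal_of_enat (filtration_order I (x [^] m)) + ennreal_of_enat (filtration_order I (x [^] n))
      \<le> ennreal_of_enat (filtration_order I (x [^] (m + n)))" for m n :: nat
    using filtration_order_mult[of "x [^] m" "x [^] n"] assms
    by (simp only: nat_pow_closed nat_pow_mult ennreal_of_enat_le_iff flip: ennreal_of_enat_add)
  then show ?thesis
    by (rule convergentI[OF fekete_superadditive_ennreal])
qed

lemma filtration_order_scaled_bounds:
  assumes "\<alpha> > 0" and f: "f \<in> carrier R"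
  shows "ennreal \<alpha> * ennreal_of_enat (filtration_order (scaled_filtration \<alpha> I) f)
      \<le> ennreal_of_enat (filtration_order I f)" (is ?upper)
    and "ennreal_of_enat (filtration_order I f)
      \<le> ennreal \<alpha> * ennreal_of_enat (filtration_order (scaled_filtration \<alpha> I) f) + ennreal \<alpha>"
      (is ?lower)
proof -
  interpret S: filtration R "scaled_filtration \<alpha> I"
    using assms(1) by (rule filtration_scaled)
  let ?a = "filtration_order I f" and ?b = "filtration_order (scaled_filtration \<alpha> I) f"
  have iff: "enat m \<le> ?b \<longleftrightarrow> enat (nat \<lceil>\<alpha> * real m\<rceil>) \<le> ?a" for m
    using S.enat_le_filtration_order_iff[OF f] enat_le_filtration_order_iff[OF f]
    by (simp add: scaled_filtration_def)
  have "?upper \<and> ?lower"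
  proof (cases ?a)
    case (enat k)
    have b: "enat m \<le> ?b \<longleftrightarrow> \<alpha> * real m \<le> real k" for m
      unfolding iff enat by (simp add: nat_le_iff ceiling_le_iff)
    \<comment> \<open>A finite order k excludes an infinite scaled order, because the multiples of
      \<alpha> eventually exceed k.\<close>
    obtain m where "real k < real m * \<alpha>"
      using reals_Archimedean3[OF assms(1)] by blast
    then have "\<not> enat m \<le> ?b" unfolding b by (simp add: mult.commute)
    then obtain j where j: "?b = enat j" by (cases ?b) auto
    \<comment> \<open>The scaled order j is the last index satisfying the inequality in
      \<open>b\<close>: it holds at j and fails at \<open>Suc j\<close>.\<close>
    have "\<alpha> * real j \<le> real k" "real k \<le> \<alpha> * real j + \<alpha>"
      using b[of j] b[of "Suc j"] j by (auto simp: algebra_simps)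
    then have "ennreal (\<alpha> * real j) \<le> ennreal (real k)"
      "ennreal (real k) \<le> ennreal (\<alpha> * real j + \<alpha>)"
      by (simp_all only: ennreal_leI)
    moreover have "ennreal (\<alpha> * real j) = ennreal \<alpha> * of_nat j"
      using assms(1) by (simp only: ennreal_of_nat_eq_real_of_nat ennreal_mult' less_imp_le)
    moreover have "ennreal (\<alpha> * real j + \<alpha>) = ennreal (\<alpha> * real j) + ennreal \<alpha>"
      using assms(1) by (intro ennreal_plus) simp_all
    ultimately show ?thesis
      by (simp only: enat j ennreal_of_enat_enat ennreal_of_nat_eq_real_of_nat)
  next
    case infinity
    \<comment> \<open>With ?a infinite, \<open>iff\<close> puts every finite m below ?b. Since
      \<alpha> > 0, the factor keeps the value infinite.\<close>
    have "\<infinity> \<le> ?b"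
      by (rule enat_leI) (simp add: iff infinity)
    then have "?b = \<infinity>" by simp
    then show ?thesis
      using infinity assms(1) by (simp add: ennreal_mult_top)
  qed
  then show ?upper ?lower by auto
qed

end

theorem theorem3p10:
  fixes R :: "('a, 'b) ring_scheme" (structure)
    and I :: "nat \<Rightarrow> 'a set"
    and \<alpha> :: real
  assumes "cring R" and "noetherian_ring R"
    and "filtration R I"
    and "\<alpha> > 0"
  shows "\<forall>x \<in> carrier R.
    asymptotic_samuel R I x = ennreal \<alpha> * asymptotic_samuel R (scaled_filtration \<alpha> I) x"
proof
  fix x assume x: "x \<in> carrier R"
  interpret filtration R I by fact
  interpret S: filtration R "scaled_filtration \<alpha> I"
    using assms(4) by (rule filtration_scaled)
  let ?a = "\<lambda>n. ennreal_of_enat (filtration_order I (x [^] n)) / of_nat n"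
  let ?b = "\<lambda>n. ennreal_of_enat (filtration_order (scaled_filtration \<alpha> I) (x [^] n)) / of_nat n"
  have a: "?a \<longlonglongrightarrow> asymptotic_samuel R I x"
    unfolding asymptotic_samuel_def
    by (rule convergent_LIMSEQ_iff[THEN iffD1, OF convergent_filtration_order_pow[OF x]])
  have "?b \<longlonglongrightarrow> asymptotic_samuel R (scaled_filtration \<alpha> I) x"
    unfolding asymptotic_samuel_def
    by (rule convergent_LIMSEQ_iff[THEN iffD1, OF S.convergent_filtration_order_pow[OF x]])
  then have b: "(\<lambda>n. ennreal \<alpha> * ?b n)
      \<longlonglongrightarrow> ennreal \<alpha> * asymptotic_samuel R (scaled_filtration \<alpha> I) x"
    by (intro ennreal_tendsto_cmult) auto
  have "(\<lambda>n. ennreal (\<alpha> / real n)) \<longlonglongrightarrow> 0"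
    using tendsto_ennrealI[OF lim_const_over_n[of \<alpha>]] by simp
  then have b': "(\<lambda>n. ennreal \<alpha> * ?b n + ennreal (\<alpha> / real n))
      \<longlonglongrightarrow> ennreal \<alpha> * asymptotic_samuel R (scaled_filtration \<alpha> I) x"
    using tendsto_add[OF b, of _ 0] by (simp only: add_0_right)
  have pow: "x [^] n \<in> carrier R" for n :: nat
    using x by (rule nat_pow_closed)
  have upper: "ennreal \<alpha> * ?b n \<le> ?a n" for n
    unfolding ennreal_times_divide
    by (intro divide_right_mono_ennreal filtration_order_scaled_bounds(1) assms(4) pow)
  have lower: "?a n \<le> ennreal \<alpha> * ?b n + ennreal (\<alpha> / real n)" if "n > 0" for n
  proof -
    \<comment> \<open>This identity fails at n = 0, where real division gives 0 and extended
      division gives infinity; hence the restriction to n > 0.\<close>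
    have "ennreal (\<alpha> / real n) = ennreal \<alpha> / of_nat n"
      using that assms(4) by (simp add: divide_ennreal ennreal_of_nat_eq_real_of_nat)
    then show ?thesis
      by (simp only: ennreal_times_divide flip: add_divide_distrib_ennreal)
        (intro divide_right_mono_ennreal filtration_order_scaled_bounds(2) assms(4) pow)
  qed
  \<comment> \<open>The two outer sequences differ by \<alpha> / n and so share their limit.\<close>
  have "?a \<longlonglongrightarrow> ennreal \<alpha> * asymptotic_samuel R (scaled_filtration \<alpha> I) x"
    by (rule tendsto_sandwich[OF _ eventually_mono[OF eventually_gt_at_top[of 0] lower] b b'])
      (simp add: upper)
  with a show "asymptotic_samuel R I x = ennreal \<alpha> * asymptotic_samuel R (scaled_filtration \<alpha> I) x"
    by (rule LIMSEQ_unique)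
qed

end
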